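(* Let $(X,d)$ be a rectangular rational metric space of cardinality $\omega_1$. Then $MA_{\omega_1}$ implies that for every uncountable one-to-one function $f\subseteq X\times X$ there is an uncountable set $A\subseteq\operatorname{dom} f$ such that $f\restriction A$ is an isometry.
   Context: A rational metric space is a metric space with all distances rational. Tuples $\bar x=(x_1,\dots,x_n),\bar y=(y_1,\dots,y_n)\in X^n$ are alike if (A1) $d(x_i,y_i)=d(x_j,y_j)$ for all $i,j$; (A2) $d(x_i,x_j)=d(y_i,y_j)$ for all $i,j$; (A3) for all $i,j$, if $x_i\neq x_j$ then $d(x_i,x_j)=d(x_i,y_j)$. A metric space $(X,d)$ is rectangular if it is uncountable and for every $n$ and every family $\{(x^\xi_1,\dots,x^\xi_n):\xi<\omega_1\}\subseteq X^n$ of tuples whose sets of entries are pairwise disjoint, there are $\xi\neq\eta<\omega_1$ such that $(x^\xi_1,\dots,x^\xi_n)$ and $(x^\eta_1,\dots,x^\eta_n)$ are alike. *)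

theory Defs
  imports "HOL-Analysis.Analysis"
begin

unbundle cardinal_syntax

abbreviation omega1 :: "nat set rel" where
  "omega1 \<equiv> cardSuc natLeq"

text \<open>
  Metric spaces are given by a carrier and a distance, as in the locale \<^locale>\<open>Metric_space\<close>.
  Tuples are lists, indexed from 0.
\<close>

definition alike :: "('a \<Rightarrow> 'a \<Rightarrow> real) \<Rightarrow> 'a list \<Rightarrow> 'a list \<Rightarrow> bool" where
  "alike d x y \<longleftrightarrow>
     length x = length y \<and>
     (\<forall>i<length x. \<forall>j<length x. d (x ! i) (y ! i) = d (x ! j) (y ! j)) \<and>
     (\<forall>i<length x. \<forall>j<length x. d (x ! i) (x ! j) = d (y ! i) (y ! j)) \<and>
     (\<forall>i<length x. \<forall>j<length x. x ! i \<noteq> x ! j \<longrightarrow> d (x ! i) (x ! j) = d (x ! i) (y ! j))"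

definition rational_metric_space :: "'a set \<Rightarrow> ('a \<Rightarrow> 'a \<Rightarrow> real) \<Rightarrow> bool" where
  "rational_metric_space X d \<longleftrightarrow> Metric_space X d \<and> (\<forall>x\<in>X. \<forall>y\<in>X. d x y \<in> \<rat>)"

text \<open>
  The ordinals below \<open>\<omega>\<^sub>1\<close> are the elements of \<^term>\<open>Field omega1\<close>.
\<close>

definition rectangular :: "'a set \<Rightarrow> ('a \<Rightarrow> 'a \<Rightarrow> real) \<Rightarrow> bool" where
  "rectangular X d \<longleftrightarrow>
     Metric_space X d \<and> uncountable X \<and>
     (\<forall>n. \<forall>t :: nat set \<Rightarrow> 'a list.
        (\<forall>\<xi>\<in>Field omega1. length (t \<xi>) = n \<and> set (t \<xi>) \<subseteq> X) \<and>
        (\<forall>\<xi>\<in>Field omega1. \<forall>\<eta>\<in>Field omega1. \<xi> \<noteq> \<eta> \<longrightarrow> set (t \<xi>) \<inter> set (t \<eta>) = {})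
        \<longrightarrow> (\<exists>\<xi>\<in>Field omega1. \<exists>\<eta>\<in>Field omega1. \<xi> \<noteq> \<eta> \<and> alike d (t \<xi>) (t \<eta>)))"

text \<open>
  Posets are pairs of a carrier \<open>P\<close> and an order \<open>le\<close>, with \<open>(p, q) \<in> le\<close> meaning that
  \<open>p\<close> is below \<open>q\<close>, i.e. is the stronger condition.
\<close>

definition compatible :: "'p set \<Rightarrow> 'p rel \<Rightarrow> 'p \<Rightarrow> 'p \<Rightarrow> bool" where
  "compatible P le p q \<longleftrightarrow> (\<exists>r\<in>P. (r, p) \<in> le \<and> (r, q) \<in> le)"

definition ccc :: "'p set \<Rightarrow> 'p rel \<Rightarrow> bool" where
  "ccc P le \<longleftrightarrow>
     (\<forall>A\<subseteq>P. (\<forall>p\<in>A. \<forall>q\<in>A. p \<noteq> q \<longrightarrow> \<not> compatible P le p q) \<longrightarrow> countable A)"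

definition dense_in_poset :: "'p set \<Rightarrow> 'p rel \<Rightarrow> 'p set \<Rightarrow> bool" where
  "dense_in_poset P le D \<longleftrightarrow> D \<subseteq> P \<and> (\<forall>p\<in>P. \<exists>q\<in>D. (q, p) \<in> le)"

definition poset_filter :: "'p set \<Rightarrow> 'p rel \<Rightarrow> 'p set \<Rightarrow> bool" where
  "poset_filter P le G \<longleftrightarrow>
     G \<subseteq> P \<and> G \<noteq> {} \<and>
     (\<forall>p\<in>G. \<forall>q\<in>P. (p, q) \<in> le \<longrightarrow> q \<in> G) \<and>
     (\<forall>p\<in>G. \<forall>q\<in>G. \<exists>r\<in>G. (r, p) \<in> le \<and> (r, q) \<in> le)"

text \<open>
  Martin's axiom for \<open>\<omega>\<^sub>1\<close> dense sets. HOL cannot quantify over types inside a formula, so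
  the posets range over those whose carrier is a subset of a given type \<open>'p\<close>. This follows from
  the unrestricted axiom for every type \<open>'p\<close>, and by the usual reduction to posets of size at most
  \<open>\<omega>\<^sub>1\<close> it is equivalent to it whenever \<open>'p\<close> is uncountable.
\<close>

definition MA_omega1 :: "'p itself \<Rightarrow> bool" where
  "MA_omega1 _ \<longleftrightarrow>
     (\<forall>(P :: 'p set) le \<D>.
        P \<noteq> {} \<and> partial_order_on P le \<and> ccc P le \<and>
        |\<D>| \<le>o omega1 \<and> (\<forall>D\<in>\<D>. dense_in_poset P le D)
        \<longrightarrow> (\<exists>G. poset_filter P le G \<and> (\<forall>D\<in>\<D>. G \<inter> D \<noteq> {})))"

definition one_to_one_function :: "('a \<times> 'b) set \<Rightarrow> bool" where
  "one_to_one_function f \<longleftrightarrow> single_valued f \<and> single_valued (f\<inverse>)"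

definition isometry_restricted_to ::
    "('a \<Rightarrow> 'a \<Rightarrow> real) \<Rightarrow> ('a \<times> 'a) set \<Rightarrow> 'a set \<Rightarrow> bool" where
  "isometry_restricted_to d f A \<longleftrightarrow>
     (\<forall>(x, y)\<in>f. \<forall>(x', y')\<in>f. x \<in> A \<and> x' \<in> A \<longrightarrow> d y y' = d x x')"

end

(*
  Thin f to an uncountable S whose pairs (x, y) have pairwise disjoint supports {x, y}. The finite
  isometric subsets of S, ordered by reverse inclusion, form a ccc poset: an uncountable set of
  conditions contains a Delta-system, and rectangularity, applied to the tuples listing the
  coordinates of all pairs outside the root, yields two conditions whose tuples are alike, which
  makes their union isometric. Distances from the root cause no trouble, because the root is
  part of every condition. Below a condition that is compatible with uncountably many pairs of S
  however it is extended, Martin's axiom gives a filter whose union is uncountable.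
*)
theory Submission
  imports Defs "HOL-Library.Countable_Set_Type"
begin

section \<open>Cardinality\<close>

lemma uncountable_iff_omega1_ordLeq: "uncountable A \<longleftrightarrow> omega1 \<le>o |A|"
  unfolding countable_card_le_natLeq
  by (metis cardSuc_ordLess_ordLeq card_of_Card_order card_of_Well_order natLeq_Card_order
      natLeq_Well_order not_ordLeq_iff_ordLess)

text \<open>Each finite subset is the \<open>set\<close> of a list. Lists of a fixed length are
  bounded by induction on the length, using \<open>|A \<times> A| = |A|\<close> for infinite
  \<open>A\<close>, and there are only countably many lengths. This later bounds the size of the
  poset of finite conditions.\<close>

lemma card_of_Fpow_infinite_ordLeq:
  assumes "infinite A"
  shows "|Fpow A| \<le>o |A|"
proof -
  let ?L = "\<lambda>n. {xs. set xs \<subseteq> A \<and> length xs = n}"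
  have L: "|?L n| \<le>o |A|" for n
  proof (induction n)
    case 0
    have "|?L 0| \<le>o |{[] :: 'a list}|"
      by (rule card_of_mono1) auto
    also have "|{[] :: 'a list}| \<le>o |A|"
      using assms by (metis card_of_singl_ordLeq finite.emptyI)
    finally show ?case .
  next
    case (Suc n)
    have "?L (Suc n) \<subseteq> (\<lambda>(x, xs). x # xs) ` (A \<times> ?L n)"
      by (force simp: length_Suc_conv)
    then have "|?L (Suc n)| \<le>o |A \<times> ?L n|"
      by (rule surj_imp_ordLeq)
    also have "|A \<times> ?L n| \<le>o |A|"
      using assms Suc by (intro card_of_Times_ordLeq_infinite_Field)
        (auto simp: Field_card_of card_of_refl ordIso_imp_ordLeq intro: card_of_card_order_on)
    finally show ?case .
  qed
  have "Fpow A \<subseteq> set ` (\<Union>n\<in>UNIV. ?L n)"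
  proof
    fix p assume "p \<in> Fpow A"
    then obtain xs where "set xs = p" "set xs \<subseteq> A"
      using finite_list by (fastforce simp: Fpow_def)
    then show "p \<in> set ` (\<Union>n\<in>UNIV. ?L n)" by auto
  qed
  then have "|Fpow A| \<le>o |\<Union>n\<in>UNIV. ?L n|"
    by (rule surj_imp_ordLeq)
  also have "|\<Union>n\<in>UNIV. ?L n| \<le>o |A|"
    using assms L infinite_iff_card_of_nat by (intro card_of_UNION_ordLeq_infinite) auto
  finally show ?thesis .
qed

text \<open>The family consists of the proper initial segments of the well-order \<open>|S|\<close>.
  Being a cardinal of size at most \<open>omega1\<close>, this order has only countable initial
  segments, and regularity of \<open>omega1\<close> bounds every countable subset. The family
  indexes the dense sets that keep the union of a filter from being countable.\<close>

lemma cofinal_countable_subsets: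
  assumes S: "|S| \<le>o omega1" "uncountable S"
  obtains \<C> where "|\<C>| \<le>o omega1" "\<And>C. C \<in> \<C> \<Longrightarrow> countable C"
    "\<And>C. C \<subseteq> S \<Longrightarrow> countable C \<Longrightarrow> \<exists>C'\<in>\<C>. C \<subseteq> C'"
proof
  let ?\<C> = "underS |S| ` S"
  have underS: "countable (underS |S| s)" if "s \<in> S" for s
  proof -
    have "|underS |S| s| <o |S|"
      using that by (intro card_of_underS[OF card_of_Card_order]) (simp add: Field_card_of)
    then have "|underS |S| s| <o omega1"
      using S(1) ordLess_ordLeq_trans by blast
    then show ?thesis
      unfolding countable_card_le_natLeq
      using cardSuc_ordLeq_ordLess[OF natLeq_Card_order card_of_Card_order] by blast
  qed
  show "|?\<C>| \<le>o omega1"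
    using S(1) card_of_image ordLeq_transitive by blast
  show "countable C" if "C \<in> ?\<C>" for C
    using that underS by auto
  show "\<exists>C'\<in>?\<C>. C \<subseteq> C'" if C: "C \<subseteq> S" "countable C" for C
  proof -
    \<comment> \<open>An \<open>s\<close> that is neither in \<open>C\<close> nor below a member of
      \<open>C\<close> is, by totality, above all of \<open>C\<close>. It exists because the
      excluded points are only countably many.\<close>
    have "countable (C \<union> (\<Union>c\<in>C. underS |S| c))"
      using C underS by auto
    then have "\<not> S \<subseteq> C \<union> (\<Union>c\<in>C. underS |S| c)"
      using S(2) countable_subset by blast
    then obtain s where s: "s \<in> S" "s \<notin> C" "\<And>c. c \<in> C \<Longrightarrow> s \<notin> underS |S| c"
      by blast
    have tot: "total_on S |S|"
      using card_of_well_order_on[of S] by (simp add: well_order_on_def linear_order_on_def)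
    have "c \<in> underS |S| s" if "c \<in> C" for c
    proof -
      have "c \<noteq> s" "c \<in> S" using that s C by auto
      then show ?thesis
        using tot s(1,3) that unfolding total_on_def underS_def by blast
    qed
    then show ?thesis using s(1) by blast
  qed
qed

section \<open>Uncountable families of countable sets\<close>

text \<open>Zorn's lemma. Symmetry of \<open>R\<close> is what lets a point related to all of
  \<open>M\<close> be added to \<open>M\<close>. The lemma serves for disjoint families and for
  antichains.\<close>

lemma maximal_pairwise_subset:
  assumes "\<And>a b. R a b \<Longrightarrow> R b a"
  obtains M where "M \<subseteq> A" "pairwise R M" "\<And>a. a \<in> A - M \<Longrightarrow> \<exists>b\<in>M. \<not> R a b"
proof -
  let ?F = "{M. M \<subseteq> A \<and> pairwise R M}"
  have "\<Union>C \<in> ?F" if "subset.chain ?F C" for C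
  proof -
    have C: "C \<subseteq> ?F" "\<And>X Y. X \<in> C \<Longrightarrow> Y \<in> C \<Longrightarrow> X \<subseteq> Y \<or> Y \<subseteq> X"
      using that by (auto simp: subset_chain_def)
    then have "pairwise R (\<Union>C)"
      by (intro pairwise_chain_Union) (auto simp: chain_subset_def)
    then show ?thesis using C(1) by blast
  qed
  then have "\<exists>M\<in>?F. \<forall>N\<in>?F. M \<subseteq> N \<longrightarrow> N = M"
    by (rule subset_Zorn')
  then obtain M where M: "M \<in> ?F" and max: "\<forall>N\<in>?F. M \<subseteq> N \<longrightarrow> N = M" ..
  have "\<exists>b\<in>M. \<not> R a b" if a: "a \<in> A - M" for a
  proof (rule ccontr)
    assume "\<not> (\<exists>b\<in>M. \<not> R a b)"
    then have "insert a M \<in> ?F"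
      using M a assms by (auto simp: pairwise_insert)
    then show False using max a by blast
  qed
  then show thesis using that M by auto
qed

text \<open>A maximal disjoint subfamily works. If it were countable, its union would be a countable
  set of points that every remaining \<open>s a\<close> must meet; since each point lies in only
  countably many \<open>s a\<close>, all of \<open>A\<close> would be countable.\<close>

lemma uncountable_disjoint_subfamily:
  assumes A: "uncountable A"
    and s: "\<And>a. a \<in> A \<Longrightarrow> countable (s a)"
    and x: "\<And>x. countable {a \<in> A. x \<in> s a}"
  shows "\<exists>B\<subseteq>A. uncountable B \<and> pairwise (\<lambda>a b. disjnt (s a) (s b)) B"
proof -
  obtain M where M: "M \<subseteq> A" "pairwise (\<lambda>a b. disjnt (s a) (s b)) M"
    and max: "\<And>a. a \<in> A - M \<Longrightarrow> \<exists>b\<in>M. \<not> disjnt (s a) (s b)"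
    using maximal_pairwise_subset[of "\<lambda>a b. disjnt (s a) (s b)" A] disjnt_sym by metis
  have "uncountable M"
  proof
    assume "countable M"
    then have "countable (M \<union> (\<Union>x\<in>(\<Union>b\<in>M. s b). {a \<in> A. x \<in> s a}))"
      using M s x by (intro countable_Un countable_UN) auto
    moreover have "A \<subseteq> M \<union> (\<Union>x\<in>(\<Union>b\<in>M. s b). {a \<in> A. x \<in> s a})"
      using max by (fastforce simp: disjnt_iff)
    ultimately show False using A countable_subset by blast
  qed
  then show ?thesis using M by blast
qed

text \<open>Induction on the size \<open>n\<close>. If some point lies in uncountably many members,
  it is removed, the induction hypothesis is applied, and the point is returned to the root.
  Otherwise a disjoint subfamily exists, with empty root.\<close>

lemma delta_system:
  assumes "uncountable A" and "\<And>a. a \<in> A \<Longrightarrow> finite a \<and> card a = n"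
  obtains B R where "B \<subseteq> A" "uncountable B" "\<And>a. a \<in> B \<Longrightarrow> R \<subseteq> a"
    "pairwise (\<lambda>a b. a \<inter> b = R) B"
  using assms
proof (induction n arbitrary: A thesis)
  case 0
  then have "A \<subseteq> {{}}" using card_0_eq by blast
  then have "countable A" by (rule countable_subset) simp
  with 0(2) show ?case by contradiction
next
  case (Suc n)
  show ?case
  proof (cases "\<exists>x. uncountable {a \<in> A. x \<in> a}")
    case True
    then obtain x where x: "uncountable {a \<in> A. x \<in> a}" ..
    let ?A = "(\<lambda>a. a - {x}) ` {a \<in> A. x \<in> a}"
    have inj: "inj_on (\<lambda>a. a - {x}) {a \<in> A. x \<in> a}"
      by (auto simp: inj_on_def)
    have "uncountable ?A"
      using x inj countable_image_inj_on by blast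
    then obtain B R where B: "B \<subseteq> ?A" "uncountable B" "\<And>a. a \<in> B \<Longrightarrow> R \<subseteq> a"
      "pairwise (\<lambda>a b. a \<inter> b = R) B"
      by (rule Suc.IH[rotated]) (use Suc.prems(3) in auto)
    show ?thesis
    proof (rule Suc.prems(1))
      have "inj_on (insert x) B"
        by (rule inj_onI) (use B(1) in \<open>auto simp: insert_ident\<close>)
      then show "uncountable (insert x ` B)"
        using B(2) countable_image_inj_on by blast
      show "insert x ` B \<subseteq> A"
      proof
        fix c assume "c \<in> insert x ` B"
        then obtain a where "a \<in> A" "x \<in> a" "c = insert x (a - {x})" using B(1) by blast
        then show "c \<in> A" by (simp add: insert_absorb)
      qed
      show "insert x R \<subseteq> a" if "a \<in> insert x ` B" for a
        using that B(3) by blast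
      show "pairwise (\<lambda>a b. a \<inter> b = insert x R) (insert x ` B)"
        using B(4) unfolding pairwise_def by blast
    qed
  next
    case False
    then have "\<exists>B\<subseteq>A. uncountable B \<and> pairwise (\<lambda>a b. disjnt a b) B"
      using Suc.prems(2,3) by (intro uncountable_disjoint_subfamily) (auto intro: countable_finite)
    then obtain B where B: "B \<subseteq> A" "uncountable B" "pairwise (\<lambda>a b. disjnt a b) B"
      by blast
    show ?thesis
      by (rule Suc.prems(1)[OF B(1,2), of "{}"]) (use B(3) in \<open>auto simp: pairwise_def disjnt_def\<close>)
  qed
qed

section \<open>Consequences of Martin's axiom\<close>

lemma cccD:
  "ccc P le \<Longrightarrow> A \<subseteq> P \<Longrightarrow>
    (\<And>p q. p \<in> A \<Longrightarrow> q \<in> A \<Longrightarrow> p \<noteq> q \<Longrightarrow> \<not> compatible P le p q) \<Longrightarrow> countable A"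
  unfolding ccc_def by simp

text \<open>Martin's axiom is available only for carriers inside \<open>'p\<close>, whereas the
  conditions are sets of pairs. The order is copied along an injection into \<open>'p\<close>, and
  the filter obtained there is pulled back.\<close>

lemma MA_omega1_transfer:
  fixes P :: "'q set"
  assumes MA: "MA_omega1 TYPE('p)" and card: "|P| \<le>o |UNIV :: 'p set|"
    and P: "P \<noteq> {}" "partial_order_on P le" "ccc P le"
    and D: "|\<D>| \<le>o omega1" "\<And>D. D \<in> \<D> \<Longrightarrow> dense_in_poset P le D"
  shows "\<exists>G. poset_filter P le G \<and> (\<forall>D\<in>\<D>. G \<inter> D \<noteq> {})"
proof -
  obtain h :: "'q \<Rightarrow> 'p" where h: "inj_on h P"
    using card card_of_ordLeq[of P "UNIV :: 'p set"] by auto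
  \<comment> \<open>The order is confined to images of elements of \<open>P\<close> because
    \<open>h\<close> is injective only there.\<close>
  define le' where "le' = {(h p, h q) | p q. p \<in> P \<and> q \<in> P \<and> (p, q) \<in> le}"
  have le': "(h p, h q) \<in> le' \<longleftrightarrow> (p, q) \<in> le" if "p \<in> P" "q \<in> P" for p q
    using that h unfolding le'_def by (auto dest: inj_onD)
  have compat: "compatible (h ` P) le' (h p) (h q) \<longleftrightarrow> compatible P le p q"
    if "p \<in> P" "q \<in> P" for p q
    using that by (auto simp: compatible_def le')
  have "refl_on P le" "trans le" "antisym le"
    using P(2) by (auto simp: partial_order_on_def preorder_on_def)
  then have "refl_on (h ` P) le'" "le' \<subseteq> h ` P \<times> h ` P"
    by (auto simp: refl_on_def le') (auto simp: le'_def)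
  moreover have "trans le'"
  proof (rule transI)
    fix a b c assume "(a, b) \<in> le'" "(b, c) \<in> le'"
    then obtain p q r where "p \<in> P" "q \<in> P" "r \<in> P" "a = h p" "b = h q" "c = h r"
      unfolding le'_def by blast
    with \<open>(a, b) \<in> le'\<close> \<open>(b, c) \<in> le'\<close> show "(a, c) \<in> le'"
      using \<open>trans le\<close> le' by (metis transD)
  qed
  moreover have "antisym le'"
  proof (rule antisymI)
    fix a b assume "(a, b) \<in> le'" "(b, a) \<in> le'"
    moreover from this obtain p q where "p \<in> P" "q \<in> P" "a = h p" "b = h q"
      unfolding le'_def by blast
    ultimately show "a = b"
      using \<open>antisym le\<close> le' by (metis antisymD)
  qed
  ultimately have po: "partial_order_on (h ` P) le'"
    by (auto simp: partial_order_on_def preorder_on_def)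
  have "ccc (h ` P) le'"
    unfolding ccc_def
  proof (intro allI impI)
    fix A assume "A \<subseteq> h ` P"
      and anti: "\<forall>p\<in>A. \<forall>q\<in>A. p \<noteq> q \<longrightarrow> \<not> compatible (h ` P) le' p q"
    then obtain A0 where A0: "A0 \<subseteq> P" "A = h ` A0"
      by (meson subset_imageE)
    have "\<not> compatible P le p q" if "p \<in> A0" "q \<in> A0" "p \<noteq> q" for p q
    proof -
      have "h p \<noteq> h q" using that A0 h by (meson inj_onD subsetD)
      then show ?thesis using that A0 anti compat by blast
    qed
    then have "countable A0" using P(3) A0 cccD by blast
    then show "countable A" using A0 by simp
  qed
  moreover have "|(`) h ` \<D>| \<le>o omega1"
    using D(1) card_of_image ordLeq_transitive by blast
  moreover have "dense_in_poset (h ` P) le' D'" if D': "D' \<in> (`) h ` \<D>" for D'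
  proof -
    obtain E where E: "E \<in> \<D>" "D' = h ` E" using D' by blast
    then have "E \<subseteq> P" and ex: "\<And>p. p \<in> P \<Longrightarrow> \<exists>q\<in>E. (q, p) \<in> le"
      using D(2) by (auto simp: dense_in_poset_def)
    have "\<exists>q\<in>h ` E. (q, h p) \<in> le'" if "p \<in> P" for p
      using ex[OF that] le' that \<open>E \<subseteq> P\<close> by blast
    then show ?thesis using E \<open>E \<subseteq> P\<close> by (auto simp: dense_in_poset_def)
  qed
  ultimately obtain G' where G': "poset_filter (h ` P) le' G'"
    and meets: "\<And>D. D \<in> \<D> \<Longrightarrow> G' \<inter> h ` D \<noteq> {}"
    using MA po P(1) unfolding MA_omega1_def
    by (metis (no_types, lifting) image_is_empty imageI)
  define G where "G = {p \<in> P. h p \<in> G'}"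
  have "G' = h ` G" using G' by (auto simp: G_def poset_filter_def)
  have "poset_filter P le G"
    unfolding poset_filter_def
  proof (intro conjI ballI impI)
    show "G \<subseteq> P" by (auto simp: G_def)
    show "G \<noteq> {}" using G' \<open>G' = h ` G\<close> by (auto simp: poset_filter_def)
    show "q \<in> G" if "p \<in> G" "q \<in> P" "(p, q) \<in> le" for p q
      using that G' le' by (auto simp: G_def poset_filter_def)
    show "\<exists>r\<in>G. (r, p) \<in> le \<and> (r, q) \<in> le" if "p \<in> G" "q \<in> G" for p q
    proof -
      have "\<exists>r\<in>G'. (r, h p) \<in> le' \<and> (r, h q) \<in> le'"
        using that G' by (auto simp: G_def poset_filter_def)
      then obtain r where "r \<in> G" "(h r, h p) \<in> le'" "(h r, h q) \<in> le'"
        using \<open>G' = h ` G\<close> by blast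
      then show ?thesis using that le' unfolding G_def by blast
    qed
  qed
  moreover have "G \<inter> D \<noteq> {}" if "D \<in> \<D>" for D
    using meets[OF that] D(2)[OF that] by (auto simp: G_def dense_in_poset_def)
  ultimately show ?thesis by blast
qed

section \<open>Uncountable homogeneous sets from ccc families of finite sets\<close>

definition supset_on :: "'b set set \<Rightarrow> 'b set rel" where
  "supset_on F = {(p, q). p \<in> F \<and> q \<in> F \<and> q \<subseteq> p}"

text \<open>The closure hypothesis asks only for unions of members that have a common upper bound in
  \<open>F\<close>. So it covers downward closed families and also their parts above a fixed
  condition, which are not downward closed.\<close>

lemma compatible_supset_on_iff:
  assumes "\<And>p q r. r \<in> F \<Longrightarrow> p \<in> F \<Longrightarrow> q \<in> F \<Longrightarrow> p \<union> q \<subseteq> r \<Longrightarrow> p \<union> q \<in> F"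
    and "p \<in> F" "q \<in> F"
  shows "compatible F (supset_on F) p q \<longleftrightarrow> p \<union> q \<in> F"
proof
  assume "compatible F (supset_on F) p q"
  then obtain r where "r \<in> F" "p \<union> q \<subseteq> r"
    by (auto simp: compatible_def supset_on_def)
  then show "p \<union> q \<in> F" using assms by blast
next
  assume "p \<union> q \<in> F"
  then show "compatible F (supset_on F) p q"
    using assms unfolding compatible_def supset_on_def by blast
qed

text \<open>The set \<open>B\<close> is the union of a filter. Directedness puts every finite subset
  of \<open>B\<close> inside one condition. For \<open>B\<close> to be uncountable, the poset is
  first cut down to the extensions of a condition \<open>p0\<close> all of whose extensions keep
  uncountably many one-point extensions.\<close>

lemma MA_uncountable_homogeneous:
  fixes S :: "'b set" and F :: "'b set set"
  assumes MA: "MA_omega1 TYPE('p)" "uncountable (UNIV :: 'p set)"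
    and S: "|S| \<le>o omega1" "uncountable S"
    and F: "F \<subseteq> Fpow S" "\<And>s. s \<in> S \<Longrightarrow> {s} \<in> F" "\<And>p q. p \<in> F \<Longrightarrow> q \<subseteq> p \<Longrightarrow> q \<in> F"
    and ccc: "ccc F (supset_on F)"
  shows "\<exists>B\<subseteq>S. uncountable B \<and> Fpow B \<subseteq> F"
proof -
  have compat: "compatible F (supset_on F) p q \<longleftrightarrow> p \<union> q \<in> F" if "p \<in> F" "q \<in> F" for p q
    using F(3) that by (intro compatible_supset_on_iff) auto
  let ?N = "\<lambda>q. {s \<in> S. insert s q \<in> F}"
  \<comment> \<open>Otherwise the conditions \<open>q\<close> with countable \<open>?N q\<close> are
    dense. A maximal antichain \<open>M\<close> of such conditions is countable by ccc, so some
    \<open>s\<close> extends no member of \<open>M\<close>. Yet a condition of this kind containing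
    \<open>s\<close> is compatible with some \<open>m\<close> in \<open>M\<close>, which makes
    \<open>insert s m\<close> a condition.\<close>
  have "\<exists>p\<in>F. \<forall>q\<in>F. p \<subseteq> q \<longrightarrow> uncountable (?N q)"
  proof (rule ccontr)
    assume "\<not> ?thesis"
    then have small: "\<exists>q\<in>F. p \<subseteq> q \<and> countable (?N q)" if "p \<in> F" for p
      using that by blast
    obtain M where M: "M \<subseteq> {q \<in> F. countable (?N q)}" "pairwise (\<lambda>p q. p \<union> q \<notin> F) M"
      and max: "\<And>a. a \<in> {q \<in> F. countable (?N q)} - M \<Longrightarrow> \<exists>b\<in>M. \<not> a \<union> b \<notin> F"
      by (rule maximal_pairwise_subset[of "\<lambda>p q. p \<union> q \<notin> F" "{q \<in> F. countable (?N q)}"])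
        (simp_all add: Un_commute)
    have "M \<subseteq> F" using M by blast
    moreover have "\<not> compatible F (supset_on F) p q" if "p \<in> M" "q \<in> M" "p \<noteq> q" for p q
      using that M compat \<open>M \<subseteq> F\<close> unfolding pairwise_def by blast
    ultimately have "countable M"
      by (rule cccD[OF ccc])
    then have "countable (\<Union>q\<in>M. ?N q)"
      using M by (intro countable_UN) auto
    then have "\<not> S \<subseteq> (\<Union>q\<in>M. ?N q)"
      using S(2) countable_subset by blast
    then obtain s where s: "s \<in> S" "\<And>q. q \<in> M \<Longrightarrow> insert s q \<notin> F"
      by blast
    obtain q where q: "q \<in> F" "s \<in> q" "countable (?N q)"
      using small[OF F(2)[OF s(1)]] by blast
    have "\<exists>m\<in>M. q \<union> m \<in> F"
    proof (cases "q \<in> M")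
      case True
      then show ?thesis using q(1) by (intro bexI[of _ q]) auto
    next
      case False
      then show ?thesis using max[of q] q by auto
    qed
    then obtain m where "m \<in> M" "q \<union> m \<in> F" ..
    moreover have "insert s m \<subseteq> q \<union> m" using q by blast
    ultimately show False using F(3) s(2) by blast
  qed
  then obtain p0 where p0: "p0 \<in> F" "\<And>q. q \<in> F \<Longrightarrow> p0 \<subseteq> q \<Longrightarrow> uncountable (?N q)"
    by blast
  define P where "P = {q \<in> F. p0 \<subseteq> q}"
  \<comment> \<open>Compatibility in \<open>P\<close> and in \<open>F\<close> both mean that the
    union lies in \<open>F\<close>, so \<open>P\<close> inherits ccc from \<open>F\<close>.\<close>
  have compatP: "compatible P (supset_on P) p q \<longleftrightarrow> p \<union> q \<in> F" if "p \<in> P" "q \<in> P" for p q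
    using F(3) that compatible_supset_on_iff[of P p q] unfolding P_def by blast
  have "ccc P (supset_on P)"
    unfolding ccc_def
  proof (intro allI impI)
    fix A assume A: "A \<subseteq> P" "\<forall>p\<in>A. \<forall>q\<in>A. p \<noteq> q \<longrightarrow> \<not> compatible P (supset_on P) p q"
    show "countable A"
    proof (rule cccD[OF ccc])
      show "A \<subseteq> F" using A(1) P_def by blast
      show "\<not> compatible F (supset_on F) p q" if "p \<in> A" "q \<in> A" "p \<noteq> q" for p q
      proof -
        have "p \<in> P" "q \<in> P" "p \<in> F" "q \<in> F" using that A(1) P_def by auto
        moreover have "\<not> compatible P (supset_on P) p q" using that A(2) by blast
        ultimately show ?thesis using compat compatP by simp
      qed
    qed
  qed
  obtain \<C> where \<C>: "|\<C>| \<le>o omega1" "\<And>C. C \<in> \<C> \<Longrightarrow> countable C"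
    "\<And>C. C \<subseteq> S \<Longrightarrow> countable C \<Longrightarrow> \<exists>C'\<in>\<C>. C \<subseteq> C'"
    by (rule cofinal_countable_subsets[OF S]) (rule that)
  \<comment> \<open>A filter meeting \<open>?D C\<close> has a union not contained in
    \<open>C\<close>. These sets are dense because the uncountable \<open>?N p\<close> always offers
    a point outside the countable \<open>C\<close>.\<close>
  let ?D = "\<lambda>C. {q \<in> P. \<not> q \<subseteq> C}"
  have dense: "dense_in_poset P (supset_on P) (?D C)" if "C \<in> \<C>" for C
    unfolding dense_in_poset_def
  proof (intro conjI ballI)
    fix p assume p: "p \<in> P"
    then have "uncountable (?N p)" using p0(2)[of p] unfolding P_def by simp
    then have "\<not> ?N p \<subseteq> C" using \<C>(2)[OF that] countable_subset by blast
    then obtain s where "s \<in> S" "insert s p \<in> F" "s \<notin> C" by blast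
    then show "\<exists>q\<in>?D C. (q, p) \<in> supset_on P"
      using p by (intro bexI[of _ "insert s p"]) (auto simp: P_def supset_on_def)
  qed auto
  \<comment> \<open>The chain of bounds passes through \<open>omega1\<close> and ends at
    \<open>'p\<close>, whose uncountability thus makes room for a copy of \<open>P\<close>.\<close>
  have "|P| \<le>o |Fpow S|"
    using F(1) by (intro card_of_mono1) (auto simp: P_def)
  also have "|Fpow S| \<le>o |S|"
    using S(2) by (simp add: card_of_Fpow_infinite_ordLeq uncountable_infinite)
  also note S(1)
  also have "omega1 \<le>o |UNIV :: 'p set|"
    using MA(2) by (simp add: uncountable_iff_omega1_ordLeq)
  finally have "|P| \<le>o |UNIV :: 'p set|" .
  moreover have "P \<noteq> {}" using p0(1) by (auto simp: P_def)
  moreover have "partial_order_on P (supset_on P)"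
    unfolding partial_order_on_def preorder_on_def supset_on_def
    by (auto simp: refl_on_def trans_def antisym_def)
  moreover have "|?D ` \<C>| \<le>o omega1"
    using \<C>(1) card_of_image ordLeq_transitive by blast
  moreover have "dense_in_poset P (supset_on P) E" if "E \<in> ?D ` \<C>" for E
    using that dense by blast
  ultimately have "\<exists>G. poset_filter P (supset_on P) G \<and> (\<forall>E\<in>?D ` \<C>. G \<inter> E \<noteq> {})"
    by (rule MA_omega1_transfer[OF MA(1) _ _ _ \<open>ccc P (supset_on P)\<close>])
  then obtain G where G: "poset_filter P (supset_on P) G \<and> (\<forall>E\<in>?D ` \<C>. G \<inter> E \<noteq> {})" ..
  then have meets: "G \<inter> ?D C \<noteq> {}" if "C \<in> \<C>" for C
    using that by simp
  from G have "poset_filter P (supset_on P) G" ..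
  then have GP: "G \<subseteq> P" "G \<noteq> {}"
    and le: "\<forall>p\<in>G. \<forall>q\<in>G. \<exists>r\<in>G. (r, p) \<in> supset_on P \<and> (r, q) \<in> supset_on P"
    by (simp_all add: poset_filter_def)
  have dir: "\<exists>r\<in>G. p \<union> q \<subseteq> r" if pq: "p \<in> G" "q \<in> G" for p q
  proof -
    obtain r where "r \<in> G" "(r, p) \<in> supset_on P" "(r, q) \<in> supset_on P"
      using le pq by blast
    then show ?thesis by (auto simp: supset_on_def)
  qed
  show ?thesis
  proof (intro exI conjI)
    show BS: "\<Union>G \<subseteq> S" using GP F(1) by (auto simp: P_def Fpow_def)
    show "uncountable (\<Union>G)"
    proof
      assume "countable (\<Union>G)"
      then have "\<exists>C\<in>\<C>. \<Union>G \<subseteq> C" by (rule \<C>(3)[OF BS])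
      then obtain C where "C \<in> \<C>" "\<Union>G \<subseteq> C" ..
      then show False using meets[of C] by auto
    qed
    show "Fpow (\<Union>G) \<subseteq> F"
    proof
      fix p assume "p \<in> Fpow (\<Union>G)"
      then have p: "finite p" "p \<subseteq> \<Union>G" by (auto simp: Fpow_def)
      have "\<exists>g\<in>G. p \<subseteq> g"
        using p
      proof (induction rule: finite_induct)
        case empty
        then show ?case using GP by blast
      next
        case (insert x p)
        then obtain g g' where "g \<in> G" "p \<subseteq> g" "g' \<in> G" "x \<in> g'" by auto
        then show ?case using dir[of g g'] by blast
      qed
      then show "p \<in> F" using GP F(3) unfolding P_def by blast
    qed
  qed
qed

section \<open>Partial isometries\<close>

definition partial_isometry :: "('a \<Rightarrow> 'a \<Rightarrow> real) \<Rightarrow> ('a \<times> 'a) set \<Rightarrow> bool" where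
  "partial_isometry d p \<longleftrightarrow> (\<forall>(x, y)\<in>p. \<forall>(x', y')\<in>p. d y y' = d x x')"

lemma partial_isometryD:
  "partial_isometry d p \<Longrightarrow> e \<in> p \<Longrightarrow> e' \<in> p \<Longrightarrow> d (snd e) (snd e') = d (fst e) (fst e')"
  unfolding partial_isometry_def by fastforce

lemma partial_isometry_subset: "partial_isometry d p \<Longrightarrow> q \<subseteq> p \<Longrightarrow> partial_isometry d q"
  unfolding partial_isometry_def by blast

text \<open>The tuple lists all first coordinates and then all second ones. For pairs at equal
  positions, (A1) at \<open>i\<close> and \<open>?n + i\<close> gives the claim. At different
  positions \<open>i\<close> and \<open>j\<close>, (A3) replaces the point from \<open>es'\<close>
  by the one at position \<open>j\<close> of \<open>es\<close>, in both coordinates, and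
  \<open>es\<close> is already isometric.\<close>

lemma alike_imp_cross_isometry:
  assumes alike: "alike d (map fst es @ map snd es) (map fst es' @ map snd es')"
    and iso: "partial_isometry d (set es)"
    and len: "length es' = length es"
    and neq: "\<And>i j. i < length es \<Longrightarrow> j < length es \<Longrightarrow> i \<noteq> j \<Longrightarrow>
      fst (es ! i) \<noteq> fst (es ! j) \<and> snd (es ! i) \<noteq> snd (es ! j)"
    and e: "e \<in> set es" "e' \<in> set es'"
  shows "d (snd e) (snd e') = d (fst e) (fst e')"
proof -
  let ?n = "length es"
  obtain i j where i: "i < ?n" "e = es ! i" and j: "j < ?n" "e' = es' ! j"
    using e len by (metis in_set_conv_nth)
  let ?t = "map fst es @ map snd es" and ?t' = "map fst es' @ map snd es'"
  have nth: "?t ! k = fst (es ! k)" "?t ! (?n + k) = snd (es ! k)"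
    "?t' ! k = fst (es' ! k)" "?t' ! (?n + k) = snd (es' ! k)" if "k < ?n" for k
    using that len by (auto simp: nth_append)
  have len2: "length ?t = ?n + ?n" by simp
  have A1: "\<And>k l. k < ?n + ?n \<Longrightarrow> l < ?n + ?n \<Longrightarrow> d (?t ! k) (?t' ! k) = d (?t ! l) (?t' ! l)"
    and A3: "\<And>k l. k < ?n + ?n \<Longrightarrow> l < ?n + ?n \<Longrightarrow> ?t ! k \<noteq> ?t ! l \<Longrightarrow>
      d (?t ! k) (?t ! l) = d (?t ! k) (?t' ! l)"
    using alike unfolding alike_def len2 by blast+
  show ?thesis
  proof (cases "i = j")
    case True
    then show ?thesis using A1[of i "?n + i"] i j by (simp add: nth)
  next
    case False
    then have "d (fst e) (fst e') = d (fst e) (fst (es ! j))"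
      using A3[of i j] neq[of i j] i j by (simp add: nth)
    moreover have "d (snd e) (snd e') = d (snd e) (snd (es ! j))"
      using False A3[of "?n + i" "?n + j"] neq[of i j] i j by (simp add: nth)
    moreover have "d (snd e) (snd (es ! j)) = d (fst e) (fst (es ! j))"
      using i j e by (intro partial_isometryD[OF iso]) auto
    ultimately show ?thesis by simp
  qed
qed

text \<open>Two pairs lying together in \<open>p\<close> or in \<open>q\<close> are settled already.
  The hypothesis \<open>cross\<close> treats one order of the remaining pairs, and symmetry of
  \<open>d\<close> gives the other.\<close>

lemma partial_isometry_Un:
  assumes "partial_isometry d p" "partial_isometry d q"
    and sym: "\<And>x y. x \<in> Field (p \<union> q) \<Longrightarrow> y \<in> Field (p \<union> q) \<Longrightarrow> d x y = d y x"
    and cross: "\<And>e e'. e \<in> p - q \<Longrightarrow> e' \<in> q - p \<Longrightarrow> d (snd e) (snd e') = d (fst e) (fst e')"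
  shows "partial_isometry d (p \<union> q)"
proof -
  have "d (snd e) (snd e') = d (fst e) (fst e')" if e: "e \<in> p \<union> q" "e' \<in> p \<union> q" for e e'
  proof -
    have F: "fst e \<in> Field (p \<union> q)" "snd e \<in> Field (p \<union> q)"
      "fst e' \<in> Field (p \<union> q)" "snd e' \<in> Field (p \<union> q)"
      using e by (metis FieldI1 FieldI2 prod.collapse)+
    consider "e \<in> p" "e' \<in> p" | "e \<in> q" "e' \<in> q" | "e \<in> p - q" "e' \<in> q - p"
      | "e' \<in> p - q" "e \<in> q - p"
      using e by blast
    then show ?thesis
      using assms(1,2) cross[of e e'] cross[of e' e] sym F by cases (simp_all add: partial_isometryD)
  qed
  then show ?thesis unfolding partial_isometry_def by fastforce
qed

lemma ccc_finite_partial_isometries: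
  assumes rect: "rectangular X d" and S: "S \<subseteq> X \<times> X"
    and disj: "pairwise (\<lambda>e e'. disjnt {fst e, snd e} {fst e', snd e'}) S"
  shows "ccc {p \<in> Fpow S. partial_isometry d p} (supset_on {p \<in> Fpow S. partial_isometry d p})"
    (is "ccc ?F _")
  unfolding ccc_def
proof (intro allI impI)
  interpret Metric_space X d using rect by (simp add: rectangular_def)
  fix A assume A: "A \<subseteq> ?F"
    and anti: "\<forall>p\<in>A. \<forall>q\<in>A. p \<noteq> q \<longrightarrow> \<not> compatible ?F (supset_on ?F) p q"
  show "countable A"
  proof (rule ccontr)
    assume "uncountable A"
    moreover have "A = (\<Union>n. {p \<in> A. card p = n})" by auto
    ultimately have "\<not> (\<forall>n\<in>UNIV. countable {p \<in> A. card p = n})"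
      using countable_UN[of UNIV "\<lambda>n. {p \<in> A. card p = n}"] by auto
    then obtain n where "uncountable {p \<in> A. card p = n}" by blast
    then obtain B R where B: "B \<subseteq> {p \<in> A. card p = n}" "uncountable B"
      "\<And>p. p \<in> B \<Longrightarrow> R \<subseteq> p" "pairwise (\<lambda>p q. p \<inter> q = R) B"
      by (rule delta_system[of "{p \<in> A. card p = n}" n]) (use A in \<open>auto simp: Fpow_def\<close>)
    have BF: "p \<subseteq> S" "finite p" "partial_isometry d p" "card p = n" if "p \<in> B" for p
      using that B(1) A by (auto simp: Fpow_def)
    \<comment> \<open>An arbitrary enumeration of the pairs outside the root. The root must be left
      out for the entries of different tuples to be disjoint, and the common size \<open>n\<close>
      gives all tuples the same length.\<close>
    define es where "es p = (SOME xs. set xs = p - R \<and> distinct xs)" for p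
    have es: "set (es p) = p - R" "distinct (es p)" "length (es p) = n - card R"
      if "p \<in> B" for p
    proof -
      have "\<exists>xs. set xs = p - R \<and> distinct xs"
        using BF(2)[OF that] by (intro finite_distinct_list) auto
      then have *: "set (es p) = p - R \<and> distinct (es p)"
        unfolding es_def by (rule someI_ex)
      then show "set (es p) = p - R" "distinct (es p)" by auto
      then show "length (es p) = n - card R"
        using B(3)[OF that] BF(2,4)[OF that]
        by (metis card_Diff_subset distinct_card finite_subset)
    qed
    define t where "t p = map fst (es p) @ map snd (es p)" for p
    have t: "set (t p) = (\<Union>e\<in>p - R. {fst e, snd e})" "length (t p) = 2 * (n - card R)"
      if "p \<in> B" for p
      using es[OF that] unfolding t_def by auto
    \<comment> \<open>Rectangularity speaks of families indexed by the countable ordinals, so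
      \<open>g\<close> reindexes a part of \<open>B\<close>. Its injectivity turns distinct indices
      into distinct conditions.\<close>
    obtain g where g: "inj_on g (Field omega1)" "g ` Field omega1 \<subseteq> B"
    proof -
      have "|Field omega1| \<le>o |B|"
        using B(2) card_of_Field_ordIso[OF cardSuc_Card_order[OF natLeq_Card_order]]
        unfolding uncountable_iff_omega1_ordLeq using ordIso_ordLeq_trans by blast
      then show thesis using that card_of_ordLeq[of "Field omega1" B] by blast
    qed
    have gB: "g \<xi> \<in> B" if "\<xi> \<in> Field omega1" for \<xi>
      using that g by blast
    have "length (t (g \<xi>)) = 2 * (n - card R) \<and> set (t (g \<xi>)) \<subseteq> X" if "\<xi> \<in> Field omega1" for \<xi>
      using t[OF gB[OF that]] BF(1)[OF gB[OF that]] S by fastforce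
    moreover have "set (t (g \<xi>)) \<inter> set (t (g \<eta>)) = {}"
      if \<xi>: "\<xi> \<in> Field omega1" and \<eta>: "\<eta> \<in> Field omega1" and "\<xi> \<noteq> \<eta>" for \<xi> \<eta>
    proof -
      have "g \<xi> \<noteq> g \<eta>" using g that by (meson inj_onD)
      then have "g \<xi> \<inter> g \<eta> = R" using B(4) gB \<xi> \<eta> by (auto simp: pairwise_def)
      have "disjnt {fst e, snd e} {fst e', snd e'}" if "e \<in> g \<xi> - R" "e' \<in> g \<eta> - R" for e e'
      proof -
        have "e \<noteq> e'" using that \<open>g \<xi> \<inter> g \<eta> = R\<close> by blast
        moreover have "e \<in> S" "e' \<in> S" using that BF(1) gB \<xi> \<eta> by blast+
        ultimately show ?thesis using disj unfolding pairwise_def by blast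
      qed
      then show ?thesis
        unfolding t(1)[OF gB[OF \<xi>]] t(1)[OF gB[OF \<eta>]] disjnt_def by blast
    qed
    ultimately obtain \<xi> \<eta> where \<xi>\<eta>: "\<xi> \<in> Field omega1" "\<eta> \<in> Field omega1" "\<xi> \<noteq> \<eta>"
      and alike: "alike d (t (g \<xi>)) (t (g \<eta>))"
      using rect[unfolded rectangular_def, THEN conjunct2, THEN conjunct2, rule_format,
          of "\<lambda>\<xi>. t (g \<xi>)" "2 * (n - card R)"] by blast
    define p q where "p = g \<xi>" and "q = g \<eta>"
    have pq: "p \<in> B" "q \<in> B" "p \<noteq> q"
      using gB \<xi>\<eta> g unfolding p_def q_def by (auto dest: inj_onD)
    then have "p \<inter> q = R" using B(4) by (auto simp: pairwise_def)
    have "partial_isometry d (p \<union> q)"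
    proof (rule partial_isometry_Un)
      show "partial_isometry d p" "partial_isometry d q" using BF pq by auto
      show "d x y = d y x" for x y by (rule commute)
      \<comment> \<open>As \<open>p \<inter> q = R\<close>, the pairs to be compared are exactly
        those listed by \<open>es p\<close> and \<open>es q\<close>; pairs from the root never occur
        here.\<close>
      show "d (snd e) (snd e') = d (fst e) (fst e')" if "e \<in> p - q" "e' \<in> q - p" for e e'
      proof (rule alike_imp_cross_isometry)
        show "alike d (map fst (es p) @ map snd (es p)) (map fst (es q) @ map snd (es q))"
          using alike unfolding t_def p_def q_def .
        show "partial_isometry d (set (es p))"
          using BF(3)[OF pq(1)] es(1)[OF pq(1)] unfolding partial_isometry_def by auto
        show "length (es q) = length (es p)" using es pq by simp
        show "e \<in> set (es p)" "e' \<in> set (es q)"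
          using that es pq \<open>p \<inter> q = R\<close> by auto
        \<comment> \<open>Different positions hold different elements of \<open>S\<close>, whose
          supports are disjoint. This licenses (A3) in each coordinate.\<close>
        show "fst (es p ! i) \<noteq> fst (es p ! j) \<and> snd (es p ! i) \<noteq> snd (es p ! j)"
          if ij: "i < length (es p)" "j < length (es p)" "i \<noteq> j" for i j
        proof -
          have "es p ! i \<noteq> es p ! j"
            using es(2)[OF pq(1)] ij by (simp add: nth_eq_iff_index_eq)
          moreover have "es p ! i \<in> S" "es p ! j \<in> S"
            using ij es(1)[OF pq(1)] BF(1)[OF pq(1)] nth_mem by blast+
          ultimately have "disjnt {fst (es p ! i), snd (es p ! i)} {fst (es p ! j), snd (es p ! j)}"
            using disj unfolding pairwise_def by blast
          then show ?thesis by (auto simp: disjnt_def)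
        qed
      qed
    qed
    then have "p \<union> q \<in> ?F" using BF pq by (auto simp: Fpow_def)
    then have "compatible ?F (supset_on ?F) p q"
      using pq B(1) A unfolding compatible_def supset_on_def by blast
    then show False using anti pq B(1) by blast
  qed
qed

section \<open>Thinning the function and extracting the isometry\<close>

theorem mainTheorem2:
  fixes X :: "'a set" and d :: "'a \<Rightarrow> 'a \<Rightarrow> real"
  assumes "rational_metric_space X d"
    and "rectangular X d"
    and "|X| =o omega1"
    and "uncountable (UNIV :: 'p set)"
    and "MA_omega1 TYPE('p)"
  shows "\<forall>f. f \<subseteq> X \<times> X \<and> uncountable f \<and> one_to_one_function f \<longrightarrow>
           (\<exists>A \<subseteq> Domain f. uncountable A \<and> isometry_restricted_to d f A)"
proof (intro allI impI, elim conjE)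
  fix f :: "('a \<times> 'a) set"
  assume f: "f \<subseteq> X \<times> X" "uncountable f" and "one_to_one_function f"
  then have fst_eq: "\<And>e e'. e \<in> f \<Longrightarrow> e' \<in> f \<Longrightarrow> fst e = fst e' \<Longrightarrow> e = e'"
    and snd_eq: "\<And>e e'. e \<in> f \<Longrightarrow> e' \<in> f \<Longrightarrow> snd e = snd e' \<Longrightarrow> e = e'"
    unfolding one_to_one_function_def single_valued_def by auto
  interpret Metric_space X d using assms(2) by (simp add: rectangular_def)
  \<comment> \<open>Injectivity of \<open>f\<close> allows at most one pair starting at
    \<open>z\<close> and at most one ending at \<open>z\<close>, so the supports can be made
    disjoint on an uncountable part.\<close>
  have "countable {e \<in> f. z \<in> {fst e, snd e}}" for z
  proof -
    have "countable (fst ` {e \<in> f. fst e = z})" "countable (snd ` {e \<in> f. snd e = z})"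
      by (auto intro: countable_subset[of _ "{z}"])
    then have "countable {e \<in> f. fst e = z}" "countable {e \<in> f. snd e = z}"
      using fst_eq snd_eq by (auto elim!: countable_image_inj_on simp: inj_on_def)
    then have "countable ({e \<in> f. fst e = z} \<union> {e \<in> f. snd e = z})" by simp
    then show ?thesis by (rule countable_subset[rotated]) auto
  qed
  then obtain S where S: "S \<subseteq> f" "uncountable S"
    "pairwise (\<lambda>e e'. disjnt {fst e, snd e} {fst e', snd e'}) S"
    using uncountable_disjoint_subfamily[OF f(2), of "\<lambda>e. {fst e, snd e}"] by auto
  have SX: "S \<subseteq> X \<times> X" using S f by blast
  let ?F = "{p \<in> Fpow S. partial_isometry d p}"
  have "|S| \<le>o |X|"
  proof (rule card_of_ordLeqI)
    show "inj_on fst S" using S(1) fst_eq unfolding inj_on_def by blast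
    show "fst e \<in> X" if "e \<in> S" for e using that SX by auto
  qed
  then have card: "|S| \<le>o omega1"
    using assms(3) ordLeq_ordIso_trans by blast
  have singleton: "{e} \<in> ?F" if "e \<in> S" for e
    using that SX by (auto simp: Fpow_def partial_isometry_def)
  have subset: "q \<in> ?F" if "p \<in> ?F" "q \<subseteq> p" for p q
    using that partial_isometry_subset by (auto simp: Fpow_def finite_subset)
  have "\<exists>B\<subseteq>S. uncountable B \<and> Fpow B \<subseteq> ?F"
    by (rule MA_uncountable_homogeneous[OF assms(5,4) card S(2) _ singleton subset
          ccc_finite_partial_isometries[OF assms(2) SX S(3)]]) auto
  then obtain B where B: "B \<subseteq> S" "uncountable B" "Fpow B \<subseteq> ?F"
    by blast
  have Bf: "B \<subseteq> f" using B S by blast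
  show "\<exists>A \<subseteq> Domain f. uncountable A \<and> isometry_restricted_to d f A"
  proof (intro exI conjI)
    show "fst ` B \<subseteq> Domain f" using Bf by force
    have "inj_on fst B" using Bf fst_eq unfolding inj_on_def by blast
    then show "uncountable (fst ` B)" using B(2) countable_image_inj_on by blast
    have "d y y' = d x x'"
      if xy: "(x, y) \<in> f" "(x', y') \<in> f" and B': "x \<in> fst ` B" "x' \<in> fst ` B" for x y x' y'
    proof -
      obtain e e' where e: "e \<in> B" "fst e = x" and e': "e' \<in> B" "fst e' = x'"
        using B' by blast
      then have "e = (x, y)" "e' = (x', y')"
        using xy Bf fst_eq[of e "(x, y)"] fst_eq[of e' "(x', y')"] by auto
      then have "(x, y) \<in> B" "(x', y') \<in> B" using e e' by simp_all
      then have "{(x, y), (x', y')} \<in> Fpow B" by (simp add: Fpow_def)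
      then have "partial_isometry d {(x, y), (x', y')}" using B(3) by blast
      then show ?thesis by (simp add: partial_isometry_def)
    qed
    then show "isometry_restricted_to d f (fst ` B)"
      unfolding isometry_restricted_to_def by blast
  qed
qed

end
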